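(* Let $f:\mathbb{R}^m\to\mathbb{R}\cup\{\infty\}$ be a closed, proper, strictly convex function, let $E\in\mathbb{R}^{n\times m}$ be a selection matrix, and let a dynamic interconnect with $m$ terminals be given that is admissible with respect to $E$ (see context). Let $(x^\star,y^\star)$ be a primal-dual solution pair and $(v^\star,i^\star)$ corresponding equilibrium voltages and currents. Suppose the two-stage Runge--Kutta discretization (with parameters $\alpha,\beta$ and stepsize $h>0$) of the circuit dynamics generates a sequence $\{(v^k,i^k,x^k,y^k)\}_{k=1}^\infty$ satisfying the sufficient dissipativity condition: there is $\eta>0$ such that for all $k=1,2,\dots$ $$\mathcal{E}_{k+1}-\mathcal{E}_k+\eta\langle x^k-x^\star,\,y^k-y^\star\rangle\le 0,\qquad \mathcal{E}_k=\tfrac12\|v^k_{\mathcal C}-v^\star_{\mathcal C}\|^2_{D_{\mathcal C}}+\tfrac12\|i^k_{\mathcal L}-i^\star_{\mathcal L}\|^2_{D_{\mathcal L}}.$$ Then $x^k$ converges to a primal solution, i.e. to a minimizer of $f$ over $\mathcal{R}(E^\top)$.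
   Context: Optimization problem: minimize $f(x)$ subject to $x\in\mathcal{R}(E^\top)$, where $\mathcal R$ and $\mathcal N$ applied to a matrix denote range and null space. Selection matrix: given a partition $N_1,\dots,N_n$ of $\{1,\dots,m\}$, $E_{ij}=1$ if $j\in N_i$ and $E_{ij}=0$ otherwise. A primal-dual solution pair $(x^\star,y^\star)$ satisfies $y^\star\in\partial f(x^\star)$, $x^\star\in\mathcal{R}(E^\top)$, $y^\star\in\mathcal{N}(E)$. Dynamic interconnect: an RLC circuit with $m$ terminals and one ground node. It has $\tau\ge m+1$ nodes; nodes $1,\dots,m$ are connected to the terminals $1,\dots,m$, and node $\tau$ is ground. It has $\sigma$ components (resistors, inductors, capacitors), each with a $+$ terminal and a $-$ terminal attached to nodes. Inductances and capacitances lie in $(0,\infty)$ and resistances lie in $[0,\infty)$; a $0$-ohm resistor is an ideal wire, and loops of ideal wires are not permitted. The reduced node incidence matrix $A\in\mathbb{R}^{(\tau-1)\times\sigma}$ (ground row removed) has $A_{ij}=+1$ if node $i$ connects to the $+$ terminal of component $j$, $A_{ij}=-1$ if node $i$ connects to the $-$ terminal of component $j$, and $A_{ij}=0$ otherwise. Vectors $v,i\in\mathbb{R}^\sigma$ (component voltages and currents) are split by component type: $v=(v_{\mathcal R},v_{\mathcal L},v_{\mathcal C})$, $i=(i_{\mathcal R},i_{\mathcal L},i_{\mathcal C})$. $D_{\mathcal R},D_{\mathcal L},D_{\mathcal C}$ are the diagonal matrices of resistances, inductances and capacitances, and $\|z\|_D^2=\langle z,Dz\rangle$. $x\in\mathbb{R}^m$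 are the terminal potentials, $y\in\mathbb{R}^m$ the currents leaving the terminals, $e\in\mathbb{R}^{\tau-1-m}$ the potentials of the non-terminal, non-ground nodes. For $(x,y)\in\mathbb{R}^m\times\mathbb{R}^m$ let $D_{x,y}$ be the set of $(v,i)$ such that, for some $e$, $Ai=\begin{bmatrix} -y \\ 0 \end{bmatrix}$, $v=A^\top\begin{bmatrix} x \\ e \end{bmatrix}$, $v_{\mathcal R}=D_{\mathcal R}i_{\mathcal R}$, $v_{\mathcal L}=0$, $i_{\mathcal C}=0$. Admissible (with respect to $E$): $\{(x,y): D_{x,y}\neq\emptyset\}=\mathcal{R}(E^\top)\times\mathcal{N}(E)$. Corresponding equilibrium voltages and currents means $(v^\star,i^\star)\in D_{x^\star,y^\star}$. Discretization: the circuit composed with $\partial f$ obeys $y\in\partial f(x)$, $Ai=\begin{bmatrix} -y \\ 0 \end{bmatrix}$, $v=A^\top\begin{bmatrix} x \\ e \end{bmatrix}$, $v_{\mathcal R}=D_{\mathcal R}i_{\mathcal R}$, $v_{\mathcal L}=D_{\mathcal L}\frac{d}{dt}i_{\mathcal L}$, $i_{\mathcal C}=D_{\mathcal C}\frac{d}{dt}v_{\mathcal C}$. The capacitor and inductor ODEs for $z=(v_{\mathcal C},i_{\mathcal L})$ are viewed as $\frac{d}{dt}z=F(z)$, where the right-hand side $(D_{\mathcal C}^{-1}i_{\mathcal C},D_{\mathcal L}^{-1}v_{\mathcal L})$ is computed from the remaining (algebraic) relations, and are discretized as $z^{k+1/2}=z^k+\alpha hF(z^k)$, $z^{k+1}=z^k+\beta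 hF(z^k)+(1-\beta)hF(z^{k+1/2})$. The other entries of $(v^k,i^k,x^k,y^k)$ are the circuit quantities associated with $z^k$ through the algebraic relations; in particular $y^k\in\partial f(x^k)$ for all $k$. *)

theory Defs
  imports "HOL-Analysis.Analysis"
begin

section \<open>Extended-real-valued convex functions\<close>

definition closed_fun :: "('a::euclidean_space \<Rightarrow> ereal) \<Rightarrow> bool" where
  "closed_fun f \<longleftrightarrow> closed {(x, t::real). f x \<le> ereal t}"

definition proper_fun :: "('a \<Rightarrow> ereal) \<Rightarrow> bool" where
  "proper_fun f \<longleftrightarrow> (\<forall>x. f x \<noteq> -\<infinity>) \<and> (\<exists>x. f x \<noteq> \<infinity>)"

definition effective_domain :: "('a \<Rightarrow> ereal) \<Rightarrow> 'a set" where
  "effective_domain f = {x. f x < \<infinity>}"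

definition strictly_convex_fun :: "('a::real_vector \<Rightarrow> ereal) \<Rightarrow> bool" where
  "strictly_convex_fun f \<longleftrightarrow>
     (\<forall>x\<in>effective_domain f. \<forall>y\<in>effective_domain f. \<forall>\<theta>::real.
        x \<noteq> y \<longrightarrow> 0 < \<theta> \<longrightarrow> \<theta> < 1 \<longrightarrow>
        f (\<theta> *\<^sub>R x + (1 - \<theta>) *\<^sub>R y) < ereal \<theta> * f x + ereal (1 - \<theta>) * f y)"

definition subdifferential :: "('a::real_inner \<Rightarrow> ereal) \<Rightarrow> 'a \<Rightarrow> 'a set" where
  "subdifferential f x = {g. \<forall>z. f z \<ge> f x + ereal (g \<bullet> (z - x))}"

section \<open>The optimization problem\<close>

definition matrix_range :: "real ^ 'c ^ 'r \<Rightarrow> (real ^ 'r) set" where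
  "matrix_range A = range (\<lambda>w. A *v w)"

definition matrix_null_space :: "real ^ 'c ^ 'r \<Rightarrow> (real ^ 'c) set" where
  "matrix_null_space A = {w. A *v w = 0}"

definition selection_matrix :: "real ^ 'm ^ 'n \<Rightarrow> bool" where
  "selection_matrix E \<longleftrightarrow>
     (\<exists>N :: 'n \<Rightarrow> 'm set. inj N \<and> partition_on UNIV (range N) \<and>
        E = (\<chi> i j. if j \<in> N i then 1 else 0))"

definition primal_solution :: "(real ^ 'm \<Rightarrow> ereal) \<Rightarrow> real ^ 'm ^ 'n \<Rightarrow> real ^ 'm \<Rightarrow> bool" where
  "primal_solution f E x \<longleftrightarrow> is_arg_min f (\<lambda>x. x \<in> matrix_range (transpose E)) x"

definition primal_dual_pair ::
  "(real ^ 'm \<Rightarrow> ereal) \<Rightarrow> real ^ 'm ^ 'n \<Rightarrow> real ^ 'm \<Rightarrow> real ^ 'm \<Rightarrow> bool" where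
  "primal_dual_pair f E x y \<longleftrightarrow>
     y \<in> subdifferential f x \<and> x \<in> matrix_range (transpose E) \<and> y \<in> matrix_null_space E"

section \<open>RLC circuits with terminals\<close>

text \<open>
  The node attached to terminal \<open>j\<close> is identified with \<open>Terminal j\<close>. The numbers of inner nodes and
  of components are natural-number parameters, because either may be zero; vectors indexed by
  components or by inner nodes are functions on \<open>nat\<close> whose values are used only below that bound.
\<close>

datatype 'm node = Terminal 'm | Inner nat | Ground

datatype component =
    is_resistor: Resistor (param: real)
  | is_inductor: Inductor (param: real)
  | is_capacitor: Capacitor (param: real)

record 'm circuit =
  n_inner :: nat
  n_comp :: nat
  comp :: "nat \<Rightarrow> component"
  pos_node :: "nat \<Rightarrow> 'm node"
  neg_node :: "nat \<Rightarrow> 'm node"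

definition nonground_nodes :: "'m circuit \<Rightarrow> 'm node set" where
  "nonground_nodes C = range Terminal \<union> Inner ` {..<n_inner C}"

definition nodes :: "'m circuit \<Rightarrow> 'm node set" where
  "nodes C = insert Ground (nonground_nodes C)"

definition resistors :: "'m circuit \<Rightarrow> nat set" where
  "resistors C = {j. j < n_comp C \<and> is_resistor (comp C j)}"

definition inductors :: "'m circuit \<Rightarrow> nat set" where
  "inductors C = {j. j < n_comp C \<and> is_inductor (comp C j)}"

definition capacitors :: "'m circuit \<Rightarrow> nat set" where
  "capacitors C = {j. j < n_comp C \<and> is_capacitor (comp C j)}"

definition ideal_wires :: "'m circuit \<Rightarrow> nat set" where
  "ideal_wires C = {j. j < n_comp C \<and> comp C j = Resistor 0}"

text \<open>
  A loop through components in \<open>S\<close>: component \<open>cs ! k\<close> joins \<open>ns ! k\<close> to the cyclically next node,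
  in either orientation. Length one is a self-loop, length two a pair of parallel components.
\<close>

definition has_loop :: "'m circuit \<Rightarrow> nat set \<Rightarrow> bool" where
  "has_loop C S \<longleftrightarrow>
     (\<exists>ns cs. cs \<noteq> [] \<and> length ns = length cs \<and> distinct ns \<and> distinct cs \<and> set cs \<subseteq> S \<and>
        (\<forall>k<length cs. {pos_node C (cs ! k), neg_node C (cs ! k)}
                        = {ns ! k, ns ! (Suc k mod length cs)}))"

definition dynamic_interconnect :: "'m circuit \<Rightarrow> bool" where
  "dynamic_interconnect C \<longleftrightarrow>
     (\<forall>j<n_comp C. pos_node C j \<in> nodes C \<and> neg_node C j \<in> nodes C) \<and>
     (\<forall>j\<in>resistors C. 0 \<le> param (comp C j)) \<and>
     (\<forall>j\<in>inductors C \<union> capacitors C. 0 < param (comp C j)) \<and>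
     \<not> has_loop C (ideal_wires C)"

text \<open>
  Entry of the incidence matrix. For a component with both ends at the same node the two
  contributions cancel, so that it draws no net current from the node and has zero voltage.
\<close>

definition incidence :: "'m circuit \<Rightarrow> 'm node \<Rightarrow> nat \<Rightarrow> real" where
  "incidence C p j = (if pos_node C j = p then 1 else 0) - (if neg_node C j = p then 1 else 0)"

text \<open>
  \<open>potential x e\<close> is the stacked vector \<open>(x, e)\<close> and \<open>injection y\<close> is \<open>(-y, 0)\<close>. The value at
  \<open>Ground\<close> is never used, as that row is removed from the incidence matrix.
\<close>

fun potential :: "real ^ 'm \<Rightarrow> (nat \<Rightarrow> real) \<Rightarrow> 'm node \<Rightarrow> real" where
  "potential x e (Terminal a) = x $ a"
| "potential x e (Inner l) = e l"
| "potential x e Ground = 0"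

fun injection :: "real ^ 'm \<Rightarrow> 'm node \<Rightarrow> real" where
  "injection y (Terminal a) = - (y $ a)"
| "injection y (Inner l) = 0"
| "injection y Ground = 0"

definition KCL :: "'m circuit \<Rightarrow> real ^ 'm \<Rightarrow> (nat \<Rightarrow> real) \<Rightarrow> bool" where
  "KCL C y i \<longleftrightarrow>
     (\<forall>p\<in>nonground_nodes C. (\<Sum>j<n_comp C. incidence C p j * i j) = injection y p)"

definition KVL :: "'m circuit \<Rightarrow> real ^ 'm \<Rightarrow> (nat \<Rightarrow> real) \<Rightarrow> (nat \<Rightarrow> real) \<Rightarrow> bool" where
  "KVL C x e v \<longleftrightarrow>
     (\<forall>j<n_comp C. v j = (\<Sum>p\<in>nonground_nodes C. incidence C p j * potential x e p))"

definition ohm :: "'m circuit \<Rightarrow> (nat \<Rightarrow> real) \<Rightarrow> (nat \<Rightarrow> real) \<Rightarrow> bool" where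
  "ohm C v i \<longleftrightarrow> (\<forall>j\<in>resistors C. v j = param (comp C j) * i j)"

definition equilibria ::
  "'m circuit \<Rightarrow> real ^ 'm \<Rightarrow> real ^ 'm \<Rightarrow> ((nat \<Rightarrow> real) \<times> (nat \<Rightarrow> real)) set" where
  "equilibria C x y =
     {(v, i). \<exists>e. KCL C y i \<and> KVL C x e v \<and> ohm C v i \<and>
                  (\<forall>j\<in>inductors C. v j = 0) \<and> (\<forall>j\<in>capacitors C. i j = 0)}"

definition admissible :: "'m::finite circuit \<Rightarrow> real ^ 'm ^ 'n \<Rightarrow> bool" where
  "admissible C E \<longleftrightarrow>
     {(x, y). equilibria C x y \<noteq> {}} = matrix_range (transpose E) \<times> matrix_null_space E"

section \<open>The discretized circuit dynamics\<close>

text \<open>The algebraic relations: everything in the dynamics except the two differential equations.\<close>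

definition algebraic_relations ::
  "'m circuit \<Rightarrow> (real ^ 'm \<Rightarrow> ereal) \<Rightarrow> (nat \<Rightarrow> real) \<Rightarrow> (nat \<Rightarrow> real) \<Rightarrow>
     real ^ 'm \<Rightarrow> real ^ 'm \<Rightarrow> bool" where
  "algebraic_relations C f v i x y \<longleftrightarrow>
     y \<in> subdifferential f x \<and> (\<exists>e. KCL C y i \<and> KVL C x e v \<and> ohm C v i)"

text \<open>\<open>z\<close> is the vector of capacitor voltages and inductor currents, indexed by component.\<close>

definition is_state ::
  "'m circuit \<Rightarrow> (nat \<Rightarrow> real) \<Rightarrow> (nat \<Rightarrow> real) \<Rightarrow> (nat \<Rightarrow> real) \<Rightarrow> bool" where
  "is_state C z v i \<longleftrightarrow> (\<forall>j\<in>capacitors C. z j = v j) \<and> (\<forall>j\<in>inductors C. z j = i j)"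

text \<open>
  The right-hand side \<open>F(z)\<close>, as the set of all values obtained by solving the algebraic relations
  for the given state. Restricted to the capacitor and inductor entries it has at most one element
  whenever the algebraic relations determine the capacitor currents and inductor voltages; the set
  formulation avoids assuming this, and the set is empty if no solution exists for \<open>z\<close>.
\<close>

definition circuit_rhs ::
  "'m circuit \<Rightarrow> (real ^ 'm \<Rightarrow> ereal) \<Rightarrow> (nat \<Rightarrow> real) \<Rightarrow> (nat \<Rightarrow> real) set" where
  "circuit_rhs C f z =
     {w. \<exists>v i x y. algebraic_relations C f v i x y \<and> is_state C z v i \<and>
           (\<forall>j\<in>capacitors C. w j = i j / param (comp C j)) \<and>
           (\<forall>j\<in>inductors C. w j = v j / param (comp C j))}"

definition rk_step ::
  "'m circuit \<Rightarrow> (real ^ 'm \<Rightarrow> ereal) \<Rightarrow> real \<Rightarrow> real \<Rightarrow> real \<Rightarrow>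
     (nat \<Rightarrow> real) \<Rightarrow> (nat \<Rightarrow> real) \<Rightarrow> bool" where
  "rk_step C f \<alpha> \<beta> h z z' \<longleftrightarrow>
     (\<exists>zh. \<exists>w\<in>circuit_rhs C f z. \<exists>wh\<in>circuit_rhs C f zh.
        \<forall>j\<in>capacitors C \<union> inductors C.
          zh j = z j + \<alpha> * h * w j \<and>
          z' j = z j + \<beta> * h * w j + (1 - \<beta>) * h * wh j)"

text \<open>Sequences start at index 1; their value at 0 is irrelevant.\<close>

definition rk_generated ::
  "'m circuit \<Rightarrow> (real ^ 'm \<Rightarrow> ereal) \<Rightarrow> real \<Rightarrow> real \<Rightarrow> real \<Rightarrow>
     (nat \<Rightarrow> nat \<Rightarrow> real) \<Rightarrow> (nat \<Rightarrow> nat \<Rightarrow> real) \<Rightarrow>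
     (nat \<Rightarrow> real ^ 'm) \<Rightarrow> (nat \<Rightarrow> real ^ 'm) \<Rightarrow> bool" where
  "rk_generated C f \<alpha> \<beta> h v i x y \<longleftrightarrow>
     (\<exists>z. \<forall>k\<ge>1. algebraic_relations C f (v k) (i k) (x k) (y k) \<and>
                is_state C (z k) (v k) (i k) \<and> rk_step C f \<alpha> \<beta> h (z k) (z (Suc k)))"

definition diag_norm_sq :: "'m circuit \<Rightarrow> nat set \<Rightarrow> (nat \<Rightarrow> real) \<Rightarrow> real" where
  "diag_norm_sq C S u = (\<Sum>j\<in>S. u j * (param (comp C j) * u j))"

definition energy ::
  "'m circuit \<Rightarrow> (nat \<Rightarrow> real) \<Rightarrow> (nat \<Rightarrow> real) \<Rightarrow> (nat \<Rightarrow> real) \<Rightarrow> (nat \<Rightarrow> real) \<Rightarrow> real" where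
  "energy C vs is v i =
     1/2 * diag_norm_sq C (capacitors C) (\<lambda>j. v j - vs j) +
     1/2 * diag_norm_sq C (inductors C) (\<lambda>j. i j - is j)"

definition sufficiently_dissipative ::
  "'m circuit \<Rightarrow> (nat \<Rightarrow> real) \<Rightarrow> (nat \<Rightarrow> real) \<Rightarrow> real ^ 'm \<Rightarrow> real ^ 'm \<Rightarrow>
     (nat \<Rightarrow> nat \<Rightarrow> real) \<Rightarrow> (nat \<Rightarrow> nat \<Rightarrow> real) \<Rightarrow>
     (nat \<Rightarrow> real ^ 'm::finite) \<Rightarrow> (nat \<Rightarrow> real ^ 'm) \<Rightarrow> bool" where
  "sufficiently_dissipative C vs is xs ys v i x y \<longleftrightarrow>
     (\<exists>\<eta>>0. \<forall>k\<ge>1.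
        energy C vs is (v (Suc k)) (i (Suc k)) - energy C vs is (v k) (i k)
          + \<eta> * ((x k - xs) \<bullet> (y k - ys)) \<le> 0)"

end

theory Submission
  imports Defs
begin

text \<open>
  Summing the dissipation inequality shows that
  \<open>\<langle>x\<^sup>k - x\<^sup>\<star>, y\<^sup>k - y\<^sup>\<star>\<rangle> \<longlonglongrightarrow> 0\<close>. This quantity dominates
  \<open>f x\<^sup>k - f x\<^sup>\<star> - \<langle>y\<^sup>\<star>, x\<^sup>k - x\<^sup>\<star>\<rangle>\<close>, the gap between \<open>f\<close> and its supporting affine function
  at \<open>x\<^sup>\<star>\<close>. By strict convexity and closedness, the gap is bounded away from zero outside every ball
  around \<open>x\<^sup>\<star>\<close>: the segment from \<open>x\<^sup>\<star>\<close> to a far point with small gap meets the sphere in a point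
  with a gap at most as large, and the sphere is compact. Hence \<open>x\<^sup>k \<longlonglongrightarrow> x\<^sup>\<star>\<close>, which is a
  primal solution because \<open>y\<^sup>\<star>\<close> is orthogonal to the range of \<open>E\<^sup>T\<close>.
\<close>

text \<open>Testing the subgradient at a point where \<open>f\<close> is finite rules out the value
  infinity at \<open>x\<close>; properness rules out minus infinity.\<close>

lemma subdifferential_finite:
  assumes "proper_fun f" "g \<in> subdifferential f x"
  obtains a where "f x = ereal a"
proof -
  obtain z where z: "f z \<noteq> \<infinity>" and "f x \<noteq> -\<infinity>"
    using assms(1) unfolding proper_fun_def by blast
  moreover have "f x + ereal (g \<bullet> (z - x)) \<le> f z"
    using assms(2) by (simp add: subdifferential_def)
  ultimately show thesis
    using that by (cases "f x") auto
qed

lemma subdifferential_ineq: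
  assumes "g \<in> subdifferential f x" "f x = ereal a" "f z \<le> ereal b"
  shows "a + g \<bullet> (z - x) \<le> b"
proof -
  have "f x + ereal (g \<bullet> (z - x)) \<le> f z"
    using assms(1) by (simp add: subdifferential_def)
  with assms(2,3) have "ereal (a + g \<bullet> (z - x)) \<le> ereal b"
    by (metis order_trans plus_ereal.simps(1))
  then show ?thesis by simp
qed

text \<open>Real upper bounds in place of the values of \<open>f\<close> let later estimates run in
  real arithmetic.\<close>

lemma strictly_convex_fun_ineq:
  assumes "strictly_convex_fun f" "f x \<le> ereal a" "f y \<le> ereal b"
    and "x \<noteq> y" "0 < \<theta>" "\<theta> < 1"
  shows "f (\<theta> *\<^sub>R x + (1 - \<theta>) *\<^sub>R y) < ereal (\<theta> * a + (1 - \<theta>) * b)"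
proof -
  have "f x < \<infinity>" "f y < \<infinity>"
    using assms(2,3) by (auto simp: less_top[symmetric])
  then have "f (\<theta> *\<^sub>R x + (1 - \<theta>) *\<^sub>R y) < ereal \<theta> * f x + ereal (1 - \<theta>) * f y"
    using assms(1,4-6) by (simp add: strictly_convex_fun_def effective_domain_def)
  also have "\<dots> \<le> ereal \<theta> * ereal a + ereal (1 - \<theta>) * ereal b"
    using assms by (intro add_mono ereal_mult_left_mono) auto
  finally show ?thesis by simp
qed

text \<open>Quantifying over real bounds \<open>b\<close>, that is, over points of the epigraph,
  makes the claim vacuous where \<open>f\<close> is infinite.\<close>

lemma strictly_convex_fun_gap_bounded_below:
  fixes f :: "'a::euclidean_space \<Rightarrow> ereal"
  assumes "closed_fun f" "strictly_convex_fun f"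
    and sub: "g \<in> subdifferential f x" and fx: "f x = ereal a" and r: "r > 0"
  obtains \<delta> where "\<delta> > 0"
    "\<And>z b. f z \<le> ereal b \<Longrightarrow> r \<le> dist z x \<Longrightarrow> a + g \<bullet> (z - x) + \<delta> \<le> b"
proof (rule ccontr)
  assume neg: "\<not> thesis"
  have "\<exists>u. u \<in> sphere x r \<and> f u \<le> ereal (a + g \<bullet> (u - x) + 1 / real (Suc n))" for n
  proof -
    have "1 / real (Suc n) > 0" by simp
    with neg that obtain z b where z: "f z \<le> ereal b" "r \<le> dist z x"
      and b: "b < a + g \<bullet> (z - x) + 1 / real (Suc n)"
      by (meson not_le)
    \<comment> \<open>The scale at which the segment from \<open>x\<close> to \<open>z\<close> meets
      the sphere of radius \<open>r\<close>.\<close>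
    define \<theta> where "\<theta> = r / dist z x"
    define u where "u = \<theta> *\<^sub>R z + (1 - \<theta>) *\<^sub>R x"
    have \<theta>: "0 < \<theta>" "\<theta> \<le> 1"
      using r z(2) by (auto simp: \<theta>_def divide_simps)
    have ux: "u - x = \<theta> *\<^sub>R (z - x)"
      by (simp add: u_def algebra_simps)
    have "z \<noteq> x" using r z(2) by auto
    have "dist x u = \<theta> * dist z x"
      using \<theta> ux by (metis abs_of_pos dist_commute dist_norm norm_scaleR)
    then have "u \<in> sphere x r"
      using \<open>z \<noteq> x\<close> by (simp add: \<theta>_def)
    have "f u \<le> ereal (\<theta> * b + (1 - \<theta>) * a)"
    \<comment> \<open>Strict convexity needs \<open>\<theta> < 1\<close>; for
      \<open>\<theta> = 1\<close> the point \<open>u\<close> is \<open>z\<close> itself.\<close>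
    proof (cases "\<theta> = 1")
      case True
      then show ?thesis using z by (simp add: u_def)
    next
      case False
      then have "f u < ereal (\<theta> * b + (1 - \<theta>) * a)"
        unfolding u_def using strictly_convex_fun_ineq[OF assms(2) z(1), of x a \<theta>] fx \<theta> \<open>z \<noteq> x\<close>
        by simp
      then show ?thesis by simp
    qed
    also have "\<theta> * b + (1 - \<theta>) * a \<le> a + g \<bullet> (u - x) + 1 / real (Suc n)"
    proof -
      \<comment> \<open>Convexity bounds the gap at \<open>u\<close> by \<open>\<theta>\<close>
        times the gap bound at \<open>z\<close>.\<close>
      have "\<theta> * (b - a - g \<bullet> (z - x)) \<le> \<theta> * (1 / real (Suc n))"
        using b \<theta> by (intro mult_left_mono) auto
      also have "\<dots> \<le> 1 / real (Suc n)"
        using \<theta> by (intro mult_left_le_one_le) auto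
      finally show ?thesis
        unfolding ux inner_scaleR_right by (simp add: algebra_simps)
    qed
    finally show ?thesis
      using \<open>u \<in> sphere x r\<close> by auto
  qed
  then obtain u where u: "\<And>n. u n \<in> sphere x r"
      "\<And>n. f (u n) \<le> ereal (a + g \<bullet> (u n - x) + 1 / real (Suc n))"
    by metis
  obtain l s where l: "l \<in> sphere x r" and s: "strict_mono s" and lim: "(u \<circ> s) \<longlonglongrightarrow> l"
    using compact_sphere[of x r] u(1) unfolding compact_def by metis
  have "(\<lambda>n. 1 / real (Suc (s n))) \<longlonglongrightarrow> 0"
    using LIMSEQ_subseq_LIMSEQ[OF LIMSEQ_Suc[OF lim_1_over_n] s] by (simp add: o_def)
  then have "(\<lambda>n. (u (s n), a + g \<bullet> (u (s n) - x) + 1 / real (Suc (s n))))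
      \<longlonglongrightarrow> (l, a + g \<bullet> (l - x) + 0)"
    using lim unfolding o_def by (intro tendsto_intros)
  \<comment> \<open>The pairs lie in the epigraph of \<open>f\<close>, which is closed, so their
    limit does too.\<close>
  then have "(l, a + g \<bullet> (l - x) + 0) \<in> {(z, t). f z \<le> ereal t}"
    using assms(1) u(2) unfolding closed_fun_def
    by (intro closed_sequentially[where l = "(l, a + g \<bullet> (l - x) + 0)"]) auto
  then have "f l \<le> ereal (a + g \<bullet> (l - x))" by simp
  moreover have "l \<noteq> x" using l r by auto
  \<comment> \<open>The gap is at most zero at both \<open>l\<close> and \<open>x\<close>, so it is
    negative at their midpoint, against the subgradient inequality.\<close>
  ultimately have "f ((1/2) *\<^sub>R l + (1 - 1/2) *\<^sub>R x)
      < ereal (1/2 * (a + g \<bullet> (l - x)) + (1 - 1/2) * a)" (is "f ?m < ereal ?c")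
    using fx by (intro strictly_convex_fun_ineq assms(2)) auto
  moreover have "?c = a + g \<bullet> (?m - x)"
    by (simp add: algebra_simps) argo
  moreover have "ereal (a + g \<bullet> (?m - x)) \<le> f ?m"
    using sub fx unfolding subdifferential_def by force
  ultimately show False by simp
qed

lemma convergent_of_vanishing_monotone_gap:
  fixes f :: "'a::euclidean_space \<Rightarrow> ereal"
  assumes f: "closed_fun f" "proper_fun f" "strictly_convex_fun f"
    and sub: "g \<in> subdifferential f a"
    and subk: "\<forall>\<^sub>F k in sequentially. y k \<in> subdifferential f (x k)"
    and lim: "(\<lambda>k. (x k - a) \<bullet> (y k - g)) \<longlonglongrightarrow> 0"
  shows "x \<longlonglongrightarrow> a"
proof (rule tendstoI)
  fix r :: real assume "r > 0"
  obtain c where c: "f a = ereal c"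
    using subdifferential_finite[OF f(2) sub] .
  obtain \<delta> where \<delta>: "\<delta> > 0"
    "\<And>z b. f z \<le> ereal b \<Longrightarrow> r \<le> dist z a \<Longrightarrow> c + g \<bullet> (z - a) + \<delta> \<le> b"
    using strictly_convex_fun_gap_bounded_below[OF f(1,3) sub c \<open>r > 0\<close>] by metis
  have "\<forall>\<^sub>F k in sequentially. (x k - a) \<bullet> (y k - g) < \<delta>"
    using lim \<delta>(1) by (simp add: order_tendstoD)
  with subk show "\<forall>\<^sub>F k in sequentially. dist (x k) a < r"
  proof eventually_elim
    case (elim k)
    obtain b where b: "f (x k) = ereal b"
      using subdifferential_finite[OF f(2) elim(1)] .
    \<comment> \<open>The subgradient at \<open>x k\<close>, tested at \<open>a\<close>, bounds the
      gap at \<open>x k\<close> by the inner product.\<close>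
    have "b + y k \<bullet> (a - x k) \<le> c"
      using subdifferential_ineq[OF elim(1) b] c by simp
    with elim(2) have "b < c + g \<bullet> (x k - a) + \<delta>"
      by (simp add: inner_diff_left inner_diff_right inner_commute)
    with \<delta>(2)[of "x k" b] b show ?case by force
  qed
qed

text \<open>Adding the subgradient inequalities, each tested at the other point, cancels the finite
  values of \<open>f\<close>.\<close>

lemma subdifferential_monotone:
  assumes "proper_fun f" "g \<in> subdifferential f x" "h \<in> subdifferential f y"
  shows "0 \<le> (x - y) \<bullet> (g - h)"
proof -
  obtain a b where ab: "f x = ereal a" "f y = ereal b"
    using assms subdifferential_finite by metis
  have "a + g \<bullet> (y - x) \<le> b" "b + h \<bullet> (x - y) \<le> a"
    using subdifferential_ineq assms(2,3) ab by (metis order_refl)+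
  then show ?thesis
    by (simp add: inner_diff_left inner_diff_right inner_commute)
qed

lemma primal_dual_pair_primal_solution:
  assumes "primal_dual_pair f E x y"
  shows "primal_solution f E x"
proof -
  have x: "x \<in> matrix_range (transpose E)" and y: "E *v y = 0"
    and sub: "y \<in> subdifferential f x"
    using assms by (auto simp: primal_dual_pair_def matrix_null_space_def)
  \<comment> \<open>Moving the transpose across the inner product turns it into a product with
    \<open>E *v y = 0\<close>.\<close>
  have orth: "y \<bullet> z = 0" if "z \<in> matrix_range (transpose E)" for z
    using that y by (auto simp: matrix_range_def inner_commute[of y] dot_lmul_matrix)
  have "f x \<le> f z" if "z \<in> matrix_range (transpose E)" for z
  proof -
    have "f x + ereal (y \<bullet> (z - x)) \<le> f z"
      using sub by (simp add: subdifferential_def)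
    then show ?thesis
      using orth[OF x] orth[OF that] by (simp add: inner_diff_right)
  qed
  then show ?thesis
    using x by (auto simp: primal_solution_def is_arg_min_linorder)
qed

text \<open>Inductances and capacitances are positive; this supplies the lower bound that makes the
  decreasing energy converge.\<close>

lemma energy_nonneg:
  assumes "dynamic_interconnect C"
  shows "0 \<le> energy C vs is v i"
proof -
  have "0 \<le> diag_norm_sq C S u" if "S \<subseteq> inductors C \<union> capacitors C" for S u
    unfolding diag_norm_sq_def
  proof (rule sum_nonneg)
    fix j assume "j \<in> S"
    then have "0 < param (comp C j)"
      using assms that by (auto simp: dynamic_interconnect_def)
    then have "0 \<le> param (comp C j) * (u j)\<^sup>2" by simp
    then show "0 \<le> u j * (param (comp C j) * u j)"
      by (simp add: power2_eq_square mult_ac)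
  qed
  then show ?thesis by (simp add: energy_def)
qed

text \<open>From \<open>N\<close> on, \<open>V\<close> decreases and is bounded below, so it
  converges; its vanishing successive differences, divided by \<open>\<eta>\<close>, squeeze
  \<open>g\<close> to zero.\<close>

lemma dissipation_tendsto_zero:
  fixes V g :: "nat \<Rightarrow> real"
  assumes "\<And>k. 0 \<le> V k" "\<eta> > 0" "\<And>k. k \<ge> N \<Longrightarrow> 0 \<le> g k"
    and diss: "\<And>k. k \<ge> N \<Longrightarrow> V (Suc k) - V k + \<eta> * g k \<le> 0"
  shows "g \<longlonglongrightarrow> 0"
proof -
  have step: "g k \<le> (V k - V (Suc k)) / \<eta>" if "k \<ge> N" for k
    using diss[OF that] assms(2) by (simp add: field_simps)
  have "decseq (\<lambda>k. V (k + N))"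
    using diss assms(2,3) by (intro decseq_SucI) (smt (verit) add_Suc le_add2 mult_nonneg_nonneg)
  then obtain L where "(\<lambda>k. V (k + N)) \<longlonglongrightarrow> L"
    using decseq_convergent[of "\<lambda>k. V (k + N)" 0] assms(1) by blast
  then have "V \<longlonglongrightarrow> L" by (rule LIMSEQ_offset)
  then have "(\<lambda>k. (V k - V (Suc k)) / \<eta>) \<longlonglongrightarrow> (L - L) / \<eta>"
    by (intro tendsto_intros LIMSEQ_Suc) (use assms(2) in auto)
  then have "(\<lambda>k. (V k - V (Suc k)) / \<eta>) \<longlonglongrightarrow> 0" by simp
  moreover have "\<forall>\<^sub>F k in sequentially. 0 \<le> g k"
    "\<forall>\<^sub>F k in sequentially. g k \<le> (V k - V (Suc k)) / \<eta>"
    by (rule eventually_sequentiallyI[of N], rule assms(3) step, assumption)+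
  ultimately show ?thesis
    by (rule tendsto_sandwich[OF _ _ tendsto_const, rotated 2])
qed

theorem lemma4p1:
  fixes f :: "real ^ 'm::finite \<Rightarrow> ereal"
    and E :: "real ^ 'm ^ 'n::finite"
    and C :: "'m circuit"
    and x_star y_star :: "real ^ 'm"
    and v_star i_star :: "nat \<Rightarrow> real"
    and \<alpha> \<beta> h :: real
    and v i :: "nat \<Rightarrow> nat \<Rightarrow> real"
    and x y :: "nat \<Rightarrow> real ^ 'm"
  assumes "closed_fun f" and "proper_fun f" and "strictly_convex_fun f"
    and "selection_matrix E"
    and "dynamic_interconnect C" and "admissible C E"
    and "primal_dual_pair f E x_star y_star"
    and "(v_star, i_star) \<in> equilibria C x_star y_star"
    and "h > 0"
    and "rk_generated C f \<alpha> \<beta> h v i x y"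
    and "sufficiently_dissipative C v_star i_star x_star y_star v i x y"
  shows "\<exists>x_lim. primal_solution f E x_lim \<and> x \<longlonglongrightarrow> x_lim"
proof -
  have sub: "y_star \<in> subdifferential f x_star"
    using assms(7) by (simp add: primal_dual_pair_def)
  have subk: "y k \<in> subdifferential f (x k)" if "k \<ge> 1" for k
    using assms(10) that by (auto simp: rk_generated_def algebraic_relations_def)
  obtain \<eta> where "\<eta> > 0" and diss: "\<And>k. k \<ge> 1 \<Longrightarrow>
      energy C v_star i_star (v (Suc k)) (i (Suc k)) - energy C v_star i_star (v k) (i k)
        + \<eta> * ((x k - x_star) \<bullet> (y k - y_star)) \<le> 0"
    using assms(11) by (auto simp: sufficiently_dissipative_def)
  \<comment> \<open>The threshold is \<open>N = 1\<close> because the sequences carry no information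
    at index 0.\<close>
  have "(\<lambda>k. (x k - x_star) \<bullet> (y k - y_star)) \<longlonglongrightarrow> 0"
    by (rule dissipation_tendsto_zero[where V = "\<lambda>k. energy C v_star i_star (v k) (i k)"
          and N = 1 and \<eta> = \<eta>])
      (use energy_nonneg[OF assms(5)] \<open>\<eta> > 0\<close> diss subdifferential_monotone[OF assms(2) subk sub]
        in auto)
  moreover have "\<forall>\<^sub>F k in sequentially. y k \<in> subdifferential f (x k)"
    using eventually_ge_at_top[of 1] by (rule eventually_mono) (rule subk)
  ultimately have "x \<longlonglongrightarrow> x_star"
    using convergent_of_vanishing_monotone_gap[OF assms(1-3) sub] by blast
  with primal_dual_pair_primal_solution[OF assms(7)] show ?thesis by blast
qed

end
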